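(* Let $n\ge 1$, let $\mathbb{N}$ be a set of unordered pairs of distinct elements of $\{1,\dots,n\}$, and let $0<\beta<1$, $0<\delta<1$, $\gamma>0$. For each $i\in\{1,\dots,n\}$ and $a\in\{0,1\}$ let $p_i(a)\in(0,1]$ and $\tau_i(a)\in(0,1]$ be given, with $\tau_i(0)+\tau_i(1)=1$. Then the device-free energy function $E:\{0,1\}^n\to\mathbb{R}$, $$E(\alpha_1,\dots,\alpha_n)=\beta\sum_{i=1}^n\bigl[-\log \tau_i(\alpha_i)\bigr]+\gamma\sum_{\{i,j\}\in\mathbb{N},\ \alpha_i\neq\alpha_j}\frac{1+e^{-|p_i(\alpha_i)-p_j(\alpha_j)|^2}}{2}+\delta\sum_{i=1}^n\bigl[-\log p_i(\alpha_i)\bigr],$$ is graph-representable.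
   Context: Interpretation: there are $n$ discrete locations; $\alpha_i\in\{0,1\}$ indicates whether an entity is present at location $i$ at the current time $t$. The received signal strength vector $s^t$ and the labels $\alpha_i^{t-1},\alpha_i^{t-2}$ at the two previous times are fixed. Here $p_i(a)=P(s^t\mid \alpha_i^t=a)$ is the signal likelihood and $\tau_i(a)=P(\alpha_i^t=a\mid\alpha_i^{t-1},\alpha_i^{t-2})$ is the temporal transition prior. $\mathbb{N}$ is the set of pairs of neighboring locations. The three sums are the temporal prior term, the spatial prior term and the signal strength likelihood term. Graph-representable: a function $E$ of $n$ binary variables is graph-representable if there exist a finite directed graph with nonnegative edge weights, two distinguished vertices (a source $s$ and a sink $t$), distinct non-terminal vertices $v_1,\dots,v_n$ (possibly together with further non-terminal vertices), and a constant $K\in\mathbb{R}$, such that for every $(x_1,\dots,x_n)\in\{0,1\}^n$, $E(x_1,\dots,x_n)$ equals $K$ plus the minimum cost of an $s$-$t$-cut $(S,T)$ among those cuts with $v_i\in S$ whenever $x_i=0$ and $v_i\in T$ whenever $x_i=1$. An $s$-$t$-cut $(S,T)$ is a partition of the vertices with $s\in S$, $t\in T$, and its cost is the sum of the weights of all edges going from a vertex of $S$ to a vertex of $T$. *)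

theory Defs
  imports Complex_Main "HOL-Library.FuncSet" "Graph_Theory.Pair_Digraph"
begin

definition st_cut :: "'v pair_pre_digraph \<Rightarrow> 'v \<Rightarrow> 'v \<Rightarrow> 'v set \<Rightarrow> 'v set \<Rightarrow> bool" where
  "st_cut G s t S T \<longleftrightarrow> S \<union> T = pverts G \<and> S \<inter> T = {} \<and> s \<in> S \<and> t \<in> T"

definition cut_cost ::
  "'v pair_pre_digraph \<Rightarrow> ('v \<times> 'v \<Rightarrow> real) \<Rightarrow> 'v set \<Rightarrow> 'v set \<Rightarrow> real" where
  "cut_cost G w S T = (\<Sum>e \<in> {e \<in> parcs G. fst e \<in> S \<and> snd e \<in> T}. w e)"

text \<open>
  \<open>E\<close> is a function on \<open>{0,1}^n\<close>, with labellings \<open>x\<close> taken from \<open>{1..n} \<rightarrow>\<^sub>E {0,1}\<close>.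
  Taking the vertices to be natural numbers loses no generality, since the graph is finite.
  The set under \<open>Min\<close> is always finite and nonempty, because the graph is finite and the
  \<open>v i\<close> are distinct and differ from the two terminals.
\<close>

definition graph_representable :: "nat \<Rightarrow> ((nat \<Rightarrow> nat) \<Rightarrow> real) \<Rightarrow> bool" where
  "graph_representable n E \<longleftrightarrow>
    (\<exists>(G :: nat pair_pre_digraph) (w :: nat \<times> nat \<Rightarrow> real) s t (v :: nat \<Rightarrow> nat) (K :: real).
      pair_fin_digraph G \<and>
      (\<forall>e \<in> parcs G. 0 \<le> w e) \<and>
      s \<in> pverts G \<and> t \<in> pverts G \<and> s \<noteq> t \<and>
      inj_on v {1..n} \<and> v ` {1..n} \<subseteq> pverts G - {s, t} \<and>
      (\<forall>x \<in> {1..n} \<rightarrow>\<^sub>E {0, 1}.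
        E x = K + Min {cut_cost G w S T | S T. st_cut G s t S T \<and>
          (\<forall>i \<in> {1..n}. (x i = 0 \<longrightarrow> v i \<in> S) \<and> (x i = 1 \<longrightarrow> v i \<in> T))}))"

text \<open>
  The neighbourhood \<open>N\<close> consists of two-element sets. The spatial summand is symmetric in
  \<open>i\<close> and \<open>j\<close>, so the sum over unordered pairs is indexed by the representatives with
  \<open>i < j\<close>, which counts every pair exactly once.
\<close>

definition device_free_energy ::
  "nat \<Rightarrow> nat set set \<Rightarrow> real \<Rightarrow> real \<Rightarrow> real \<Rightarrow> (nat \<Rightarrow> nat \<Rightarrow> real) \<Rightarrow> (nat \<Rightarrow> nat \<Rightarrow> real)
    \<Rightarrow> (nat \<Rightarrow> nat) \<Rightarrow> real" where
  "device_free_energy n N \<beta> \<gamma> \<delta> p \<tau> \<alpha> =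
     \<beta> * (\<Sum>i=1..n. - ln (\<tau> i (\<alpha> i)))
     + \<gamma> * (\<Sum>(i, j) \<in> {(i, j). i < j \<and> {i, j} \<in> N \<and> \<alpha> i \<noteq> \<alpha> j}.
         (1 + exp (- (\<bar>p i (\<alpha> i) - p j (\<alpha> j)\<bar>\<^sup>2))) / 2)
     + \<delta> * (\<Sum>i=1..n. - ln (p i (\<alpha> i)))"

end

theory Submission
  imports Defs
begin

text \<open>
  The spatial summand vanishes when the two labels agree and is nonnegative when they differ, so it
  is the cost of two antiparallel edges between the vertices of the pair, one edge for each way in
  which the labels can differ. The unary terms are nonnegative, so they become the weights of the
  edges at the terminals. No further vertices are needed: a labelling then determines its cut
  uniquely, and the cost of that cut is the energy.
\<close>

lemma labelling_partition:
  fixes x :: "nat \<Rightarrow> nat"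
  assumes "x \<in> {1..n} \<rightarrow>\<^sub>E {0, 1}"
  shows "{i \<in> {1..n}. x i = 0} \<union> {i \<in> {1..n}. x i = 1} = {1..n}"
proof (rule set_eqI)
  show "i \<in> {i \<in> {1..n}. x i = 0} \<union> {i \<in> {1..n}. x i = 1} \<longleftrightarrow> i \<in> {1..n}" for i
    using PiE_mem[OF assms, of i] by auto
qed

text \<open>The sets forced by \<open>x\<close>, each with its terminal added, are disjoint and
  already exhaust the vertices. A partition whose sides contain them has no vertex left to place.
  Here \<open>0\<close> is the source, \<open>Suc n\<close> the sink, and location \<open>i\<close>
  is its own vertex.\<close>

lemma st_cut_labelling_unique:
  fixes x :: "nat \<Rightarrow> nat"
  assumes "x \<in> {1..n} \<rightarrow>\<^sub>E {0, 1}" and "pverts G = {0..Suc n}"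
  shows "st_cut G 0 (Suc n) S T \<and> (\<forall>i\<in>{1..n}. (x i = 0 \<longrightarrow> i \<in> S) \<and> (x i = 1 \<longrightarrow> i \<in> T)) \<longleftrightarrow>
    S = insert 0 {i \<in> {1..n}. x i = 0} \<and> T = insert (Suc n) {i \<in> {1..n}. x i = 1}"
    (is "?L \<longleftrightarrow> S = ?S \<and> T = ?T")
proof -
  have "{0..Suc n} = insert 0 (insert (Suc n) {1..n})"
    by auto
  then have V: "pverts G = ?S \<union> ?T"
    using labelling_partition[OF assms(1)] assms(2) by auto
  have "?S \<inter> ?T = {}"
    by auto
  moreover have "?L \<longleftrightarrow> S \<union> T = ?S \<union> ?T \<and> S \<inter> T = {} \<and> ?S \<subseteq> S \<and> ?T \<subseteq> T"
    by (auto simp: st_cut_def V)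
  ultimately show ?thesis
    by blast
qed

text \<open>An arc from \<open>i\<close> to \<open>j\<close> is cut exactly when \<open>i\<close>
  has label 0 and \<open>j\<close> has label 1, so \<open>c i j\<close> can serve directly as its
  weight, and \<open>c\<close> may be asymmetric.\<close>

lemma graph_representable_unary_plus_pairwise:
  fixes u c :: "nat \<Rightarrow> nat \<Rightarrow> real"
  assumes u: "\<And>i a. i \<in> {1..n} \<Longrightarrow> a \<in> {0, 1} \<Longrightarrow> 0 \<le> u i a"
    and c: "\<And>i j. i \<in> {1..n} \<Longrightarrow> j \<in> {1..n} \<Longrightarrow> 0 \<le> c i j"
    and E: "\<And>x. x \<in> {1..n} \<rightarrow>\<^sub>E {0, 1} \<Longrightarrow>
      E x = (\<Sum>i=1..n. u i (x i)) + (\<Sum>i | i \<in> {1..n} \<and> x i = 0. \<Sum>j | j \<in> {1..n} \<and> x j = 1. c i j)"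
  shows "graph_representable n E"
proof -
  \<comment> \<open>All arcs that avoid entering the source and leaving the sink are present, so the
    arcs crossing a cut form a full rectangle. Loops are included but never cross.\<close>
  define G where "G = \<lparr>pverts = {0..Suc n}, parcs = {0..n} \<times> {1..Suc n}\<rparr>"
  \<comment> \<open>Label 1 puts \<open>b\<close> on the sink side and cuts its arc from the source,
    which therefore carries \<open>u b 1\<close>; dually, the arc from \<open>a\<close> to the sink
    carries \<open>u a 0\<close>. The arc from source to sink crosses every cut and gets weight 0,
    so that \<open>K\<close> can be 0.\<close>
  define w where "w = (\<lambda>(a, b).
    if a = 0 then if b = Suc n then 0 else u b 1 else if b = Suc n then u a 0 else c a b)"
  have "pair_fin_digraph G"
    by unfold_locales (auto simp: G_def)
  moreover have "\<forall>e \<in> parcs G. 0 \<le> w e"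
    using u c by (auto simp: G_def w_def)
  moreover have "E x = 0 + Min {cut_cost G w S T | S T. st_cut G 0 (Suc n) S T \<and>
      (\<forall>i \<in> {1..n}. (x i = 0 \<longrightarrow> i \<in> S) \<and> (x i = 1 \<longrightarrow> i \<in> T))}"
    if x: "x \<in> {1..n} \<rightarrow>\<^sub>E {0, 1}" for x
  proof -
    define A where "A = {i \<in> {1..n}. x i = 0}"
    define B where "B = {i \<in> {1..n}. x i = 1}"
    have [simp]: "finite A" "finite B" "0 \<notin> A" "Suc n \<notin> A" "0 \<notin> B" "Suc n \<notin> B"
      by (auto simp: A_def B_def)
    have disj: "A \<inter> B = {}"
      by (auto simp: A_def B_def)
    have un: "A \<union> B = {1..n}"
      unfolding A_def B_def by (rule labelling_partition[OF x])
    have "{e \<in> parcs G. fst e \<in> insert 0 A \<and> snd e \<in> insert (Suc n) B}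
        = insert 0 A \<times> insert (Suc n) B"
      by (auto simp: G_def A_def B_def)
    then have "cut_cost G w (insert 0 A) (insert (Suc n) B)
        = (\<Sum>a\<in>insert 0 A. \<Sum>b\<in>insert (Suc n) B. w (a, b))"
      by (simp only: cut_cost_def sum.cartesian_product case_prod_eta)
    also have "\<dots> = (\<Sum>b\<in>B. w (0, b)) + (\<Sum>a\<in>A. w (a, Suc n)) + (\<Sum>a\<in>A. \<Sum>b\<in>B. w (a, b))"
      by (simp add: sum.distrib w_def)
    also have "(\<Sum>b\<in>B. w (0, b)) = (\<Sum>b\<in>B. u b (x b))"
      by (rule sum.cong) (auto simp: w_def B_def)
    also have "(\<Sum>a\<in>A. w (a, Suc n)) = (\<Sum>a\<in>A. u a (x a))"
      by (rule sum.cong) (auto simp: w_def A_def)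
    also have "(\<Sum>a\<in>A. \<Sum>b\<in>B. w (a, b)) = (\<Sum>a\<in>A. \<Sum>b\<in>B. c a b)"
      by (intro sum.cong) (auto simp: w_def A_def B_def)
    also have "(\<Sum>b\<in>B. u b (x b)) + (\<Sum>a\<in>A. u a (x a)) = (\<Sum>i=1..n. u i (x i))"
      unfolding un[symmetric] using disj by (subst sum.union_disjoint) auto
    finally have "cut_cost G w (insert 0 A) (insert (Suc n) B) = E x"
      by (simp only: E[OF x] A_def B_def)
    moreover have "pverts G = {0..Suc n}"
      by (simp add: G_def)
    \<comment> \<open>Only one cut is compatible with \<open>x\<close>, so the minimum is taken over
      a singleton.\<close>
    ultimately show ?thesis
      unfolding st_cut_labelling_unique[OF x \<open>pverts G = _\<close>] by (simp add: A_def B_def)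
  qed
  moreover have "0 \<in> pverts G" "Suc n \<in> pverts G" "{1..n} \<subseteq> pverts G - {0, Suc n}"
    by (auto simp: G_def)
  ultimately show ?thesis
    unfolding graph_representable_def
    by (intro exI[of _ G] exI[of _ w] exI[of _ "0::nat"] exI[of _ "Suc n"] exI[of _ "\<lambda>i. i"]
        exI[of _ "0::real"]) simp
qed

text \<open>A discordant pair has exactly one end with label 0, so it can be ordered by label
  instead of by index; \<open>sym\<close> makes the summand indifferent to this. Assumption
  \<open>N\<close> keeps both ends in the range where labels are 0 or 1.\<close>

lemma sum_discordant_pairs:
  fixes g :: "nat \<Rightarrow> nat \<Rightarrow> nat \<Rightarrow> nat \<Rightarrow> real"
  assumes N: "\<And>i j. {i, j} \<in> N \<Longrightarrow> i \<in> {1..n} \<and> j \<in> {1..n}"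
    and sym: "\<And>i j a b. g i a j b = g j b i a"
    and x: "x \<in> {1..n} \<rightarrow>\<^sub>E {0, 1}"
  shows "(\<Sum>(i, j) \<in> {(i, j). i < j \<and> {i, j} \<in> N \<and> x i \<noteq> x j}. g i (x i) j (x j))
    = (\<Sum>i | i \<in> {1..n} \<and> x i = 0. \<Sum>j | j \<in> {1..n} \<and> x j = 1. if {i, j} \<in> N then g i 0 j 1 else 0)"
proof -
  define P where "P = {i \<in> {1..n}. x i = 0} \<times> {j \<in> {1..n}. x j = 1}"
  define Q where "Q = {(i, j). i < j \<and> {i, j} \<in> N \<and> x i \<noteq> x j}"
  have x01: "x i = 0 \<or> x i = 1" if "i \<in> {1..n}" for i
    using PiE_mem[OF x that] by simp
  have QP: "(i, j) \<in> P \<and> x i = 0 \<or> (j, i) \<in> P \<and> x i = 1" if "(i, j) \<in> Q" for i j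
    using that N[of i j] x01[of i] x01[of j] by (auto simp: P_def Q_def)
  have "(\<Sum>(i, j)\<in>Q. g i (x i) j (x j)) = (\<Sum>(i, j)\<in>{(i, j) \<in> P. {i, j} \<in> N}. g i 0 j 1)"
  \<comment> \<open>The map \<open>j\<close> puts the end with label 0 first; its inverse
    \<open>i\<close> restores increasing order of the indices.\<close>
  proof (rule sum.reindex_bij_witness[where
        i = "\<lambda>(i, j). if i < j then (i, j) else (j, i)" and
        j = "\<lambda>(i, j). if x i = 0 then (i, j) else (j, i)"])
    show "(case e of (i, j) \<Rightarrow> if x i = 0 then (i, j) else (j, i)) \<in> {(i, j) \<in> P. {i, j} \<in> N}"
      if "e \<in> Q" for e
      using that QP[of "fst e" "snd e"] by (auto simp: Q_def insert_commute)
    show "(case e of (i, j) \<Rightarrow> if i < j then (i, j) else (j, i)) \<in> Q"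
      if "e \<in> {(i, j) \<in> P. {i, j} \<in> N}" for e
    proof (cases e)
      case (Pair i j)
      with that have "x i = 0" "x j = 1" "{i, j} \<in> N"
        by (auto simp: P_def)
      moreover from this have "i \<noteq> j"
        by auto
      ultimately show ?thesis
        using Pair by (auto simp: Q_def insert_commute)
    qed
    show "(case case e of (i, j) \<Rightarrow> if x i = 0 then (i, j) else (j, i) of
        (i, j) \<Rightarrow> g i 0 j 1) = (case e of (i, j) \<Rightarrow> g i (x i) j (x j))"
      if "e \<in> Q" for e
      using that QP[of "fst e" "snd e"] sym[of "fst e"] by (auto simp: P_def split: prod.split)
  qed (auto simp: P_def Q_def)
  also have "\<dots> = (\<Sum>(i, j)\<in>P. if {i, j} \<in> N then g i 0 j 1 else 0)"
    by (rule sum.mono_neutral_cong_left) (auto simp: P_def split: if_splits)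
  also have "\<dots> = (\<Sum>i | i \<in> {1..n} \<and> x i = 0. \<Sum>j | j \<in> {1..n} \<and> x j = 1.
      if {i, j} \<in> N then g i 0 j 1 else 0)"
    by (simp add: P_def sum.cartesian_product)
  finally show ?thesis
    by (simp add: Q_def)
qed

theorem corollary1:
  fixes n :: nat and N :: "nat set set"
    and \<beta> \<gamma> \<delta> :: real
    and p \<tau> :: "nat \<Rightarrow> nat \<Rightarrow> real"
  assumes "n \<ge> 1"
    and "N \<subseteq> {e. e \<subseteq> {1..n} \<and> card e = 2}"
    and "0 < \<beta>" and "\<beta> < 1"
    and "0 < \<delta>" and "\<delta> < 1"
    and "\<gamma> > 0"
    and "\<And>i a. i \<in> {1..n} \<Longrightarrow> a \<in> {0, 1} \<Longrightarrow> p i a \<in> {0<..1}"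
    and "\<And>i a. i \<in> {1..n} \<Longrightarrow> a \<in> {0, 1} \<Longrightarrow> \<tau> i a \<in> {0<..1}"
    and "\<And>i. i \<in> {1..n} \<Longrightarrow> \<tau> i 0 + \<tau> i 1 = 1"
  shows "graph_representable n (device_free_energy n N \<beta> \<gamma> \<delta> p \<tau>)"
proof (rule graph_representable_unary_plus_pairwise)
  define g where "g i a j b = (1 + exp (- (\<bar>p i a - p j b\<bar>\<^sup>2))) / 2" for i a j b
  let ?u = "\<lambda>i a. \<beta> * - ln (\<tau> i a) + \<delta> * - ln (p i a)"
  \<comment> \<open>The labels 0 and 1 are fixed because the arc is cut only under them. The
    opposite arc carries the penalty for the swapped labels, which may differ, as it involves
    \<open>p i 1\<close> and \<open>p j 0\<close>.\<close>
  let ?c = "\<lambda>i j. \<gamma> * (if {i, j} \<in> N then g i 0 j 1 else 0)"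
  show "0 \<le> ?u i a" if "i \<in> {1..n}" "a \<in> {0, 1}" for i a
    using assms(8,9)[OF that] assms(3,5) by (intro add_nonneg_nonneg mult_nonneg_nonneg) auto
  show "0 \<le> ?c i j" for i j
    using assms(7) by (simp add: g_def add_nonneg_nonneg)
  show "device_free_energy n N \<beta> \<gamma> \<delta> p \<tau> x = (\<Sum>i=1..n. ?u i (x i))
      + (\<Sum>i | i \<in> {1..n} \<and> x i = 0. \<Sum>j | j \<in> {1..n} \<and> x j = 1. ?c i j)"
    if x: "x \<in> {1..n} \<rightarrow>\<^sub>E {0, 1}" for x
  proof -
    have N: "i \<in> {1..n} \<and> j \<in> {1..n}" if "{i, j} \<in> N" for i j
      using that assms(2) by blast
    have sym: "g i a j b = g j b i a" for i a j b
      by (simp add: g_def power2_commute)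
    have "(\<Sum>(i, j) \<in> {(i, j). i < j \<and> {i, j} \<in> N \<and> x i \<noteq> x j}. g i (x i) j (x j))
        = (\<Sum>i | i \<in> {1..n} \<and> x i = 0. \<Sum>j | j \<in> {1..n} \<and> x j = 1.
            if {i, j} \<in> N then g i 0 j 1 else 0)"
      by (rule sum_discordant_pairs[OF N sym x])
    then show ?thesis
      unfolding device_free_energy_def g_def[symmetric]
      by (simp add: sum.distrib sum_distrib_left[symmetric] del: mult_minus_right)
  qed
qed

end
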